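(* Let $A$ be a skew left brace of finite weight. If the lattice of ideals of $A$ contained in $A^{(2)}$ satisfies the descending chain condition, then $\omega(A)=\omega(A/A^{(2)})$.
   Context: A skew left brace is a triple $(A,+,\circ)$ where $(A,+)$ and $(A,\circ)$ are (not necessarily abelian) groups with $a\circ(b+c)=a\circ b-a+a\circ c$ for all $a,b,c\in A$. Put $\lambda_a(b)=-a+a\circ b$ and $a*b=\lambda_a(b)-b=-a+a\circ b-b$. An ideal of $A$ is a subgroup $I$ of $(A,+)$ that is normal in $(A,+)$, satisfies $\lambda_a(I)\subseteq I$ for all $a\in A$, and is a normal subgroup of $(A,\circ)$; then $A/I$ is a skew left brace. A subset $S\subseteq A$ generates $A$ (as an ideal) if the smallest ideal of $A$ containing $S$ is $A$. The weight $\omega(A)$ of a non-zero skew left brace $A$ is the minimal number of elements of $A$ needed to generate $A$ as an ideal; by convention $\omega(0)=1$. $A$ has finite weight if it is generated as an ideal by a finite subset. $A^{(2)}$ is the additive subgroup generated by all $a*b$ with $a,b\in A$; it is an ideal of $A$. *)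

theory Defs
  imports "HOL-Algebra.AbelCoset" "HOL-Algebra.Generated_Groups" "HOL-Library.Extended_Nat"
begin

text \<open>
  A skew left brace is carried by a \<open>ring\<close> record: \<open>\<oplus>\<close> is the (possibly
  non-commutative) additive operation and \<open>\<otimes>\<close> is the circle operation.
\<close>

locale skew_left_brace =
  fixes A :: "('a, 'b) ring_scheme" (structure)
  assumes additive_group: "group (add_monoid A)"
    and circle_group: "group A"
    and brace_distrib: "\<lbrakk>a \<in> carrier A; b \<in> carrier A; c \<in> carrier A\<rbrakk> \<Longrightarrow>
      a \<otimes> (b \<oplus> c) = (a \<otimes> b \<ominus> a) \<oplus> a \<otimes> c"

definition brace_lambda :: "('a, 'b) ring_scheme \<Rightarrow> 'a \<Rightarrow> 'a \<Rightarrow> 'a"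
  where "brace_lambda A a b = \<ominus>\<^bsub>A\<^esub> a \<oplus>\<^bsub>A\<^esub> a \<otimes>\<^bsub>A\<^esub> b"

definition brace_star :: "('a, 'b) ring_scheme \<Rightarrow> 'a \<Rightarrow> 'a \<Rightarrow> 'a"
  where "brace_star A a b = brace_lambda A a b \<ominus>\<^bsub>A\<^esub> b"

definition brace_ideal :: "'a set \<Rightarrow> ('a, 'b) ring_scheme \<Rightarrow> bool"
  where "brace_ideal I A \<longleftrightarrow>
    I \<lhd> add_monoid A \<and> (\<forall>a\<in>carrier A. brace_lambda A a ` I \<subseteq> I) \<and> I \<lhd> A"

definition brace_genideal :: "('a, 'b) ring_scheme \<Rightarrow> 'a set \<Rightarrow> 'a set"
  where "brace_genideal A S = \<Inter>{I. brace_ideal I A \<and> S \<subseteq> I}"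

definition ideal_generates :: "('a, 'b) ring_scheme \<Rightarrow> 'a set \<Rightarrow> bool"
  where "ideal_generates A S \<longleftrightarrow> S \<subseteq> carrier A \<and> brace_genideal A S = carrier A"

definition finite_weight :: "('a, 'b) ring_scheme \<Rightarrow> bool"
  where "finite_weight A \<longleftrightarrow> (\<exists>S. finite S \<and> ideal_generates A S)"

text \<open>The weight is \<open>\<infinity>\<close> if there is no finite generating set, as \<open>Inf {} = \<infinity>\<close>.\<close>

definition brace_weight :: "('a, 'b) ring_scheme \<Rightarrow> enat"
  where "brace_weight A =
    (if carrier A = {\<zero>\<^bsub>A\<^esub>} then 1
     else Inf {enat (card S) | S. finite S \<and> ideal_generates A S})"

definition brace_square :: "('a, 'b) ring_scheme \<Rightarrow> 'a set"
  where "brace_square A =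
    generate (add_monoid A) {brace_star A a b | a b. a \<in> carrier A \<and> b \<in> carrier A}"

text \<open>
  For an ideal \<open>I\<close>, additive and circle cosets coincide, and both operations on
  cosets are the elementwise operations on subsets; hence the additive and circle groups of
  the quotient are the factor groups by \<open>I\<close>.
\<close>

definition brace_quot :: "('a, 'b) ring_scheme \<Rightarrow> 'a set \<Rightarrow> 'a set ring"
  where "brace_quot A I =
    \<lparr>carrier = a_rcosets\<^bsub>A\<^esub> I, mult = set_mult A, one = I, zero = I, add = set_add A\<rparr>"

definition ideals_below :: "('a, 'b) ring_scheme \<Rightarrow> 'a set \<Rightarrow> 'a set set"
  where "ideals_below A J = {I. brace_ideal I A \<and> I \<subseteq> J}"

definition descending_chain_condition :: "'a set set \<Rightarrow> bool"
  where "descending_chain_condition L \<longleftrightarrow>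
    (\<forall>I :: nat \<Rightarrow> 'a set. range I \<subseteq> L \<and> antimono I \<longrightarrow> (\<exists>n. \<forall>m\<ge>n. I m = I n))"

end

theory Submission
  imports Defs
begin

text \<open>
  A maximal ideal \<open>M\<close> not containing \<open>A\<^sup>(\<^sup>2\<^sup>)\<close> is prime with respect to intersections: if ideals
  \<open>I\<close>, \<open>J\<close> are not contained in \<open>M\<close>, they both cover \<open>A / M\<close>, so \<open>I * J \<subseteq> I \<inter> J\<close> cannot be contained
  in \<open>M\<close>. Hence infinitely many such maximal ideals \<open>M\<^sub>0, M\<^sub>1, \<dots>\<close> would make
  \<open>A\<^sup>(\<^sup>2\<^sup>) \<inter> M\<^sub>0 \<inter> \<dots> \<inter> M\<^sub>n\<close> strictly decreasing, and so there are only finitely many. As in the Chinese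
  remainder theorem, any \<open>y\<close> can be moved by an element \<open>g\<close> of \<open>A\<^sup>(\<^sup>2\<^sup>)\<close> such that \<open>y + g\<close> avoids all of
  them. If \<open>y\<close> and \<open>T\<close> generate \<open>A\<close> modulo \<open>A\<^sup>(\<^sup>2\<^sup>)\<close>, then \<open>y + g\<close> and \<open>T\<close> generate \<open>A\<close>: by finite
  weight a proper ideal containing them lies in a maximal ideal, which contains \<open>A\<^sup>(\<^sup>2\<^sup>)\<close> by the choice of
  \<open>g\<close>, hence also \<open>y\<close> and \<open>T\<close>.
\<close>

section \<open>Basic identities for the two operations and the lambda maps\<close>

context skew_left_brace
begin

sublocale group A
  by (rule circle_group)

text \<open>The rewrites turn the group lemmas for the additive group into facts in ring notation,
  about \<open>\<oplus>\<close>, \<open>\<ominus>\<close> and \<open>\<zero>\<close>.\<close>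

sublocale add: group "add_monoid A"
  rewrites "carrier (add_monoid A) = carrier A"
    and "mult (add_monoid A) = add A"
    and "one (add_monoid A) = zero A"
    and "m_inv (add_monoid A) = a_inv A"
  by (rule additive_group) (auto simp: a_inv_def)

lemma add_cancel [simp]:
  assumes "x \<in> carrier A" "y \<in> carrier A"
  shows "\<ominus> x \<oplus> (x \<oplus> y) = y" "x \<oplus> (\<ominus> x \<oplus> y) = y"
  using assms by (simp_all flip: add.m_assoc)

text \<open>Distributivity with left factor \<open>\<one>\<close> and sum
  \<open>\<zero> \<oplus> \<zero>\<close> collapses to
  \<open>\<ominus> \<one> = \<zero>\<close>.\<close>

lemma one_eq_zero: "\<one> = \<zero>"
proof -
  have "\<one> \<otimes> (\<zero> \<oplus> \<zero>) = (\<one> \<otimes> \<zero> \<ominus> \<one>) \<oplus> \<one> \<otimes> \<zero>"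
    by (rule brace_distrib) auto
  then have "\<ominus> \<one> = \<zero>"
    by (simp add: a_minus_def)
  then show ?thesis
    by (metis add.inv_inv add.inv_one one_closed)
qed

lemma lambda_closed [simp]:
  "a \<in> carrier A \<Longrightarrow> b \<in> carrier A \<Longrightarrow> brace_lambda A a b \<in> carrier A"
  by (simp add: brace_lambda_def)

lemma star_closed [simp]:
  "a \<in> carrier A \<Longrightarrow> b \<in> carrier A \<Longrightarrow> brace_star A a b \<in> carrier A"
  by (simp add: brace_star_def a_minus_def)

lemma circ_eq: "a \<in> carrier A \<Longrightarrow> b \<in> carrier A \<Longrightarrow> a \<otimes> b = a \<oplus> brace_lambda A a b"
  by (simp add: brace_lambda_def)

lemma lambda_eq: "a \<in> carrier A \<Longrightarrow> b \<in> carrier A \<Longrightarrow> brace_lambda A a b = brace_star A a b \<oplus> b"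
  by (simp add: brace_star_def a_minus_def add.m_assoc)

lemma lambda_add:
  "a \<in> carrier A \<Longrightarrow> b \<in> carrier A \<Longrightarrow> c \<in> carrier A \<Longrightarrow>
    brace_lambda A a (b \<oplus> c) = brace_lambda A a b \<oplus> brace_lambda A a c"
  by (simp add: brace_lambda_def brace_distrib a_minus_def add.m_assoc)

lemma lambda_one: "b \<in> carrier A \<Longrightarrow> brace_lambda A \<one> b = b"
  using one_eq_zero by (simp add: brace_lambda_def)

text \<open>Expand the triple circle product along both bracketings and cancel
  \<open>a \<otimes> b\<close> on the left. Together with \<open>lambda_add\<close> and
  \<open>lambda_one\<close>, this makes lambda an action of the circle group on the additive
  group.\<close>

lemma lambda_circ:
  assumes "a \<in> carrier A" "b \<in> carrier A" "c \<in> carrier A"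
  shows "brace_lambda A (a \<otimes> b) c = brace_lambda A a (brace_lambda A b c)"
proof -
  have "(a \<otimes> b) \<otimes> c = a \<otimes> (b \<oplus> brace_lambda A b c)"
    using assms by (simp add: m_assoc flip: circ_eq)
  also have "\<dots> = a \<otimes> b \<oplus> brace_lambda A a (brace_lambda A b c)"
    using assms by (simp add: brace_distrib a_minus_def add.m_assoc brace_lambda_def[of A a])
  finally show ?thesis
    using assms by (simp add: brace_lambda_def[of A "a \<otimes> b"])
qed

lemma lambda_hom:
  assumes "a \<in> carrier A"
  shows "group_hom (add_monoid A) (add_monoid A) (brace_lambda A a)"
  using assms additive_group by unfold_locales (auto simp: hom_def lambda_add)

lemma lambda_minus:
  assumes "a \<in> carrier A" "b \<in> carrier A"
  shows "brace_lambda A a (\<ominus> b) = \<ominus> brace_lambda A a b"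
  using group_hom.hom_inv[OF lambda_hom[OF assms(1)], of b] assms by (simp flip: a_inv_def)

lemma star_zero_left: "x \<in> carrier A \<Longrightarrow> brace_star A \<zero> x = \<zero>"
  using lambda_one by (simp add: brace_star_def one_eq_zero a_minus_def)

lemma star_zero_right:
  assumes "x \<in> carrier A"
  shows "brace_star A x \<zero> = \<zero>"
proof -
  have "x \<otimes> \<zero> = x"
    using assms by (metis one_eq_zero r_one)
  then show ?thesis
    using assms by (simp add: brace_star_def brace_lambda_def a_minus_def)
qed

section \<open>Ideals by elementwise closure conditions, and generating sets\<close>

lemma brace_ideal_iff:
  "brace_ideal I A \<longleftrightarrow> I \<subseteq> carrier A \<and> \<zero> \<in> I \<and> (\<forall>x\<in>I. \<forall>y\<in>I. x \<oplus> y \<in> I) \<and> (\<forall>x\<in>I. \<ominus> x \<in> I) \<and>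
    (\<forall>a\<in>carrier A. \<forall>x\<in>I. a \<oplus> x \<oplus> \<ominus> a \<in> I \<and> brace_lambda A a x \<in> I \<and> a \<otimes> x \<otimes> inv a \<in> I)"
    (is "_ \<longleftrightarrow> ?R")
proof
  assume I: "brace_ideal I A"
  then interpret N: normal I "add_monoid A"
    by (simp add: brace_ideal_def)
  show ?R
    using I N.subset N.one_closed N.m_closed N.m_inv_closed N.inv_op_closed2
      normal.inv_op_closed2[of I A]
    unfolding brace_ideal_def by (simp flip: a_inv_def) blast
next
  assume R: ?R
  then have sub: "x \<in> I \<Longrightarrow> x \<in> carrier A" for x
    by auto
  have "subgroup I (add_monoid A)"
    using R by (intro add.subgroupI) (auto simp flip: a_inv_def)
  then have 1: "I \<lhd> add_monoid A"
    using R by (simp add: add.normal_inv_iff)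
  \<comment> \<open>Circle closure comes from the additive one and lambda-invariance: products by
    \<open>circ_eq\<close>, and inverses because \<open>inv x \<otimes> x = \<zero>\<close> gives
    \<open>inv x = \<ominus> brace_lambda A (inv x) x\<close>.\<close>
  have "subgroup I A"
  proof
    show "x \<otimes> y \<in> I" if "x \<in> I" "y \<in> I" for x y
      using that R by (simp add: sub circ_eq)
    show "\<one> \<in> I"
      using R by (simp add: one_eq_zero)
    show "inv x \<in> I" if "x \<in> I" for x
    proof -
      have "inv x \<oplus> brace_lambda A (inv x) x = \<zero>"
        using that by (simp add: sub one_eq_zero flip: circ_eq)
      then have "inv x = \<ominus> brace_lambda A (inv x) x"
        using that by (metis add.inv_equality add.inv_inv inv_closed lambda_closed sub)
      then show ?thesis
        using that R by (metis inv_closed sub)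
    qed
  qed (use R in simp)
  then have "I \<lhd> A"
    using R by (simp add: normal_inv_iff)
  with 1 show "brace_ideal I A"
    using R by (simp add: brace_ideal_def image_subset_iff)
qed

lemma brace_ideal_subset: "brace_ideal I A \<Longrightarrow> I \<subseteq> carrier A"
  by (simp add: brace_ideal_iff)

lemma brace_ideal_carrier: "brace_ideal (carrier A) A"
  by (simp add: brace_ideal_iff)

lemma brace_ideal_zero: "brace_ideal {\<zero>} A"
proof -
  have "brace_lambda A a \<zero> = \<zero>" "a \<otimes> \<zero> \<otimes> inv a = \<zero>" if "a \<in> carrier A" for a
    using that by (simp add: lambda_eq star_zero_right) (metis one_eq_zero r_inv r_one that)
  then show ?thesis
    by (simp add: brace_ideal_iff)
qed

lemma brace_ideal_Int: "brace_ideal I A \<Longrightarrow> brace_ideal J A \<Longrightarrow> brace_ideal (I \<inter> J) A"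
  by (auto simp: brace_ideal_iff)

text \<open>Only closure under sums involves two elements of the union; comparability places both in
  one member of the chain.\<close>

lemma brace_ideal_Union_chain:
  assumes "C \<noteq> {}" "\<And>I. I \<in> C \<Longrightarrow> brace_ideal I A"
    and "\<And>I J. I \<in> C \<Longrightarrow> J \<in> C \<Longrightarrow> I \<subseteq> J \<or> J \<subseteq> I"
  shows "brace_ideal (\<Union>C) A"
proof -
  have "x \<oplus> y \<in> \<Union>C" if xy: "x \<in> \<Union>C" "y \<in> \<Union>C" for x y
  proof -
    obtain I J where IJ: "x \<in> I" "I \<in> C" "y \<in> J" "J \<in> C"
      using xy by blast
    have "I \<subseteq> J \<or> J \<subseteq> I"
      using assms(3) IJ by simp
    then obtain K where "x \<in> K" "y \<in> K" "K \<in> C"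
      using IJ by blast
    moreover have "brace_ideal K A"
      by (rule assms(2)) fact
    ultimately show ?thesis
      unfolding brace_ideal_iff by blast
  qed
  moreover have "\<zero> \<in> \<Union>C"
  proof -
    obtain I where "I \<in> C"
      using assms(1) by blast
    with assms(2)[of I] show ?thesis
      unfolding brace_ideal_iff by blast
  qed
  moreover have "\<Union>C \<subseteq> carrier A"
    using assms(2) brace_ideal_subset by blast
  moreover have "\<ominus> x \<in> \<Union>C \<and> (\<forall>a\<in>carrier A. a \<oplus> x \<oplus> \<ominus> a \<in> \<Union>C \<and>
      brace_lambda A a x \<in> \<Union>C \<and> a \<otimes> x \<otimes> inv a \<in> \<Union>C)" if x: "x \<in> \<Union>C" for x
  proof -
    obtain I where "x \<in> I" "I \<in> C"
      using x by blast
    with assms(2)[of I] show ?thesis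
      unfolding brace_ideal_iff by blast
  qed
  ultimately show ?thesis
    unfolding brace_ideal_iff by blast
qed

text \<open>The intersection is over a nonempty family, as the carrier is an ideal, so it is
  everything exactly when each member is.\<close>

lemma ideal_generates_iff:
  "ideal_generates A S \<longleftrightarrow> S \<subseteq> carrier A \<and> (\<forall>I. brace_ideal I A \<and> S \<subseteq> I \<longrightarrow> I = carrier A)"
proof -
  have "carrier A \<in> {I. brace_ideal I A \<and> S \<subseteq> I}" if "S \<subseteq> carrier A"
    using that brace_ideal_carrier by simp
  then show ?thesis
    unfolding ideal_generates_def brace_genideal_def using brace_ideal_subset by blast
qed

text \<open>The zero ideal contains the empty set. This gives the lower bound 1 on the weight and
  supplies a generator to modify.\<close>

lemma ideal_generates_nonempty:
  assumes "ideal_generates A S" "carrier A \<noteq> {\<zero>}"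
  shows "S \<noteq> {}"
  using assms brace_ideal_zero by (auto simp: ideal_generates_iff)

section \<open>The ideal \<open>brace_square A\<close>\<close>

lemma star_mem_square: "a \<in> carrier A \<Longrightarrow> b \<in> carrier A \<Longrightarrow> brace_star A a b \<in> brace_square A"
  unfolding brace_square_def by (rule generate.incl) auto

lemma brace_square_subset:
  assumes "brace_ideal I A" "\<And>a b. a \<in> carrier A \<Longrightarrow> b \<in> carrier A \<Longrightarrow> brace_star A a b \<in> I"
  shows "brace_square A \<subseteq> I"
  unfolding brace_square_def
  by (rule add.generate_subgroup_incl)
    (use assms in \<open>auto simp: brace_ideal_def intro: normal_imp_subgroup\<close>)

text \<open>Additivity of lambda expresses the conjugate of a star as a combination of two stars, so
  conjugates of generators stay in \<open>brace_square A\<close>.\<close>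

lemma star_conj:
  assumes "a \<in> carrier A" "b \<in> carrier A" "c \<in> carrier A"
  shows "b \<oplus> brace_star A a c \<oplus> \<ominus> b = \<ominus> brace_star A a b \<oplus> brace_star A a (b \<oplus> c)"
  using assms by (simp add: brace_star_def lambda_add a_minus_def add.m_assoc add.inv_mult_group)

text \<open>Since lambda is an action, applying it for \<open>c\<close> after \<open>a\<close>
  equals applying it for the conjugate of \<open>a\<close> after \<open>c\<close>. Hence lambda maps
  permute the generators of \<open>brace_square A\<close>.\<close>

lemma lambda_star:
  assumes "a \<in> carrier A" "b \<in> carrier A" "c \<in> carrier A"
  shows "brace_lambda A c (brace_star A a b) = brace_star A (c \<otimes> a \<otimes> inv c) (brace_lambda A c b)"
proof -
  have "brace_lambda A (c \<otimes> a \<otimes> inv c) (brace_lambda A c b) = brace_lambda A c (brace_lambda A a b)"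
    using assms by (simp add: m_assoc flip: lambda_circ)
  then show ?thesis
    using assms by (simp add: brace_star_def lambda_add lambda_minus a_minus_def)
qed

lemma brace_ideal_square: "brace_ideal (brace_square A) A"
proof -
  let ?X = "{brace_star A a b | a b. a \<in> carrier A \<and> b \<in> carrier A}" and ?I = "brace_square A"
  have X: "?X \<subseteq> carrier A"
    by auto
  interpret I: subgroup ?I "add_monoid A"
    unfolding brace_square_def by (rule add.generate_is_subgroup) (use X in auto)
  have sub: "x \<in> carrier A" if "x \<in> ?I" for x
    using I.mem_carrier[OF that] by simp
  have add: "x \<oplus> y \<in> ?I" if "x \<in> ?I" "y \<in> ?I" for x y
    using I.m_closed[OF that] by simp
  have neg: "\<ominus> x \<in> ?I" if "x \<in> ?I" for x
    using I.m_inv_closed[OF that] by (simp flip: a_inv_def)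
  have zero: "\<zero> \<in> ?I"
    using I.one_closed by simp
  \<comment> \<open>An additive endomorphism need only be checked on the generators. It is applied
    to additive conjugations and to lambda maps.\<close>
  have hom: "f x \<in> ?I" if f: "group_hom (add_monoid A) (add_monoid A) f"
    and gen: "\<And>a b. a \<in> carrier A \<Longrightarrow> b \<in> carrier A \<Longrightarrow> f (brace_star A a b) \<in> ?I"
    and x: "x \<in> ?I" for f x
  proof -
    have "f ` ?I = generate (add_monoid A) (f ` ?X)"
      unfolding brace_square_def using group_hom.generate_img[OF f] X by simp
    also have "\<dots> \<subseteq> ?I"
      by (rule add.generate_subgroup_incl) (use gen in \<open>auto intro: I.subgroup_axioms\<close>)
    finally show ?thesis
      using x by auto
  qed
  have conj: "a \<oplus> x \<oplus> \<ominus> a \<in> ?I" if a: "a \<in> carrier A" and x: "x \<in> ?I" for a x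
  proof (rule hom[OF _ _ x])
    show "group_hom (add_monoid A) (add_monoid A) (\<lambda>x. a \<oplus> x \<oplus> \<ominus> a)"
      using a additive_group by unfold_locales (auto simp: hom_def add.m_assoc)
    show "a \<oplus> brace_star A b c \<oplus> \<ominus> a \<in> ?I" if "b \<in> carrier A" "c \<in> carrier A" for b c
      using a that by (simp add: star_conj add neg star_mem_square)
  qed
  have lam: "brace_lambda A a x \<in> ?I" if a: "a \<in> carrier A" and x: "x \<in> ?I" for a x
    by (rule hom[OF lambda_hom[OF a] _ x]) (simp add: a lambda_star star_mem_square)
  \<comment> \<open>The stars \<open>s\<close> and \<open>t\<close> measure how far circle products
    with \<open>inv a\<close> are from sums. As lambda of \<open>a\<close> sends
    \<open>inv a\<close> to \<open>\<ominus> a\<close>, the circle conjugate becomes the additive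
    conjugate by \<open>a\<close> of an element of \<open>?I\<close>.\<close>
  have circ: "a \<otimes> x \<otimes> inv a \<in> ?I" if a: "a \<in> carrier A" and x: "x \<in> ?I" for a x
  proof -
    define s where "s = brace_star A (a \<otimes> x) (inv a)"
    define t where "t = brace_star A a (inv a)"
    have st: "s \<in> ?I" "t \<in> ?I"
      using a sub[OF x] by (simp_all add: s_def t_def star_mem_square)
    have c: "x \<in> carrier A" "s \<in> carrier A" "t \<in> carrier A" "inv a \<in> carrier A"
      by (rule sub[OF x] sub[OF st(1)] sub[OF st(2)] inv_closed[OF a])+
    have "t \<oplus> inv a = brace_lambda A a (inv a)"
      using a by (simp add: t_def lambda_eq)
    also have "\<dots> = \<ominus> a"
      using a one_eq_zero by (simp add: brace_lambda_def)
    finally have inv: "inv a = \<ominus> t \<oplus> \<ominus> a"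
      using add_cancel(1)[of t "inv a"] c by metis
    have "a \<otimes> x \<otimes> inv a = a \<otimes> x \<oplus> (s \<oplus> inv a)"
      using a c by (simp add: s_def circ_eq[of "a \<otimes> x"] lambda_eq)
    also have "\<dots> = a \<oplus> (brace_lambda A a x \<oplus> (s \<oplus> \<ominus> t)) \<oplus> \<ominus> a"
      using a c by (simp add: inv circ_eq[of a x] add.m_assoc)
    finally show ?thesis
      by (simp only: conj[OF a add[OF lam[OF a x] add[OF st(1) neg[OF st(2)]]]])
  qed
  show ?thesis
    by (simp add: brace_ideal_iff subset_iff sub add neg zero conj lam circ)
qed

end

section \<open>Surjective homomorphisms of skew left braces\<close>

locale brace_epi = A: skew_left_brace A + B: skew_left_brace B
  for A :: "('a, 'b) ring_scheme" and B :: "('c, 'd) ring_scheme" +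
  fixes h :: "'a \<Rightarrow> 'c"
  assumes hom_add: "\<lbrakk>a \<in> carrier A; b \<in> carrier A\<rbrakk> \<Longrightarrow> h (a \<oplus>\<^bsub>A\<^esub> b) = h a \<oplus>\<^bsub>B\<^esub> h b"
    and hom_circ: "\<lbrakk>a \<in> carrier A; b \<in> carrier A\<rbrakk> \<Longrightarrow> h (a \<otimes>\<^bsub>A\<^esub> b) = h a \<otimes>\<^bsub>B\<^esub> h b"
    and surj: "h ` carrier A = carrier B"
begin

lemma hom_closed [simp]: "a \<in> carrier A \<Longrightarrow> h a \<in> carrier B"
  using surj by auto

lemma add_hom: "group_hom (add_monoid A) (add_monoid B) h"
  using A.additive_group B.additive_group
  by (simp add: group_hom_def group_hom_axioms_def hom_def hom_add)

lemma circ_hom: "group_hom A B h"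
  using A.circle_group B.circle_group
  by (simp add: group_hom_def group_hom_axioms_def hom_def hom_circ)

lemma hom_zero: "h \<zero>\<^bsub>A\<^esub> = \<zero>\<^bsub>B\<^esub>"
  using group_hom.hom_one[OF add_hom] by simp

lemma hom_minus: "a \<in> carrier A \<Longrightarrow> h (\<ominus>\<^bsub>A\<^esub> a) = \<ominus>\<^bsub>B\<^esub> h a"
  using group_hom.hom_inv[OF add_hom, of a] by (simp flip: a_inv_def)

lemma hom_inv: "a \<in> carrier A \<Longrightarrow> h (inv\<^bsub>A\<^esub> a) = inv\<^bsub>B\<^esub> h a"
  by (rule group_hom.hom_inv[OF circ_hom])

lemma hom_lambda:
  "a \<in> carrier A \<Longrightarrow> b \<in> carrier A \<Longrightarrow> h (brace_lambda A a b) = brace_lambda B (h a) (h b)"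
  by (simp add: brace_lambda_def hom_add hom_circ hom_minus)

lemma hom_star:
  "a \<in> carrier A \<Longrightarrow> b \<in> carrier A \<Longrightarrow> h (brace_star A a b) = brace_star B (h a) (h b)"
  by (simp add: brace_star_def a_minus_def hom_add hom_minus hom_lambda)

lemma brace_ideal_vimage:
  assumes "brace_ideal J B"
  shows "brace_ideal {a \<in> carrier A. h a \<in> J} A"
  using assms
  by (simp add: A.brace_ideal_iff B.brace_ideal_iff hom_add hom_circ hom_minus hom_zero hom_inv
      hom_lambda)

text \<open>By surjectivity every element of \<open>B\<close> acting on the image comes from
  \<open>A\<close>, so each closure condition is the image of one for \<open>I\<close>.\<close>

lemma brace_ideal_image:
  assumes "brace_ideal I A"
  shows "brace_ideal (h ` I) B"
proof -
  have c: "x \<in> carrier A" if "x \<in> I" for x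
    using that A.brace_ideal_subset[OF assms] by auto
  have I: "\<zero>\<^bsub>A\<^esub> \<in> I" "\<And>x y. x \<in> I \<Longrightarrow> y \<in> I \<Longrightarrow> x \<oplus>\<^bsub>A\<^esub> y \<in> I" "\<And>x. x \<in> I \<Longrightarrow> \<ominus>\<^bsub>A\<^esub> x \<in> I"
    "\<And>a x. a \<in> carrier A \<Longrightarrow> x \<in> I \<Longrightarrow> a \<oplus>\<^bsub>A\<^esub> x \<oplus>\<^bsub>A\<^esub> \<ominus>\<^bsub>A\<^esub> a \<in> I"
    "\<And>a x. a \<in> carrier A \<Longrightarrow> x \<in> I \<Longrightarrow> brace_lambda A a x \<in> I"
    "\<And>a x. a \<in> carrier A \<Longrightarrow> x \<in> I \<Longrightarrow> a \<otimes>\<^bsub>A\<^esub> x \<otimes>\<^bsub>A\<^esub> inv\<^bsub>A\<^esub> a \<in> I"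
    using assms by (simp_all add: A.brace_ideal_iff)
  have "\<zero>\<^bsub>B\<^esub> \<in> h ` I"
    using imageI[OF I(1), of h] by (simp add: hom_zero)
  moreover have "h x \<oplus>\<^bsub>B\<^esub> h y \<in> h ` I" if "x \<in> I" "y \<in> I" for x y
    using imageI[OF I(2)[OF that], of h] that by (simp add: hom_add c)
  moreover have "\<ominus>\<^bsub>B\<^esub> h x \<in> h ` I" if "x \<in> I" for x
    using imageI[OF I(3)[OF that], of h] that by (simp add: hom_minus c)
  moreover have "h a \<oplus>\<^bsub>B\<^esub> h x \<oplus>\<^bsub>B\<^esub> \<ominus>\<^bsub>B\<^esub> h a \<in> h ` I" if "a \<in> carrier A" "x \<in> I" for a x
    using imageI[OF I(4)[OF that], of h] that by (simp add: hom_add hom_minus c)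
  moreover have "brace_lambda B (h a) (h x) \<in> h ` I" if "a \<in> carrier A" "x \<in> I" for a x
    using imageI[OF I(5)[OF that], of h] that by (simp add: hom_lambda c)
  moreover have "h a \<otimes>\<^bsub>B\<^esub> h x \<otimes>\<^bsub>B\<^esub> inv\<^bsub>B\<^esub> h a \<in> h ` I" if "a \<in> carrier A" "x \<in> I" for a x
    using imageI[OF I(6)[OF that], of h] that by (simp add: hom_circ hom_inv c)
  ultimately show ?thesis
    using c by (simp add: B.brace_ideal_iff image_subset_iff flip: surj)
qed

end

section \<open>Quotients by ideals\<close>

lemma group_record_cong:
  assumes "group G" "carrier H = carrier G" "mult H = mult G" "one H = one G"
  shows "group H"
  using assms unfolding group_def monoid_def group_axioms_def Units_def by simp

context skew_left_brace
begin

text \<open>Lambda of \<open>a\<close> maps \<open>I\<close> onto itself, with inverse lambda of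
  \<open>inv a\<close>, so left cosets agree by \<open>circ_eq\<close>; normality in both groups
  passes to right cosets. This lets one carrier serve both factor groups.\<close>

lemma circ_coset_eq_add_coset:
  assumes I: "brace_ideal I A" and a: "a \<in> carrier A"
  shows "I #> a = I +> a"
proof -
  interpret N: normal I "add_monoid A"
    using I by (simp add: brace_ideal_def)
  interpret C: normal I A
    using I by (simp add: brace_ideal_def)
  have lam: "brace_lambda A b x \<in> I" if "b \<in> carrier A" "x \<in> I" for b x
    using I that by (simp add: brace_ideal_iff)
  have c: "x \<in> carrier A" if "x \<in> I" for x
    using that brace_ideal_subset[OF I] by auto
  have "a <# I = a <+ I"
  proof (intro equalityI subsetI)
    fix y assume "y \<in> a <# I"
    then obtain x where "x \<in> I" "y = a \<oplus> brace_lambda A a x"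
      using a c by (auto simp: l_coset_def circ_eq)
    then show "y \<in> a <+ I"
      using lam[OF a] by (auto simp: a_l_coset_def')
  next
    fix y assume "y \<in> a <+ I"
    then obtain x where x: "x \<in> I" "y = a \<oplus> x"
      by (auto simp: a_l_coset_def')
    have "brace_lambda A a (brace_lambda A (inv a) x) = x"
      using a c[OF x(1)] by (simp add: lambda_one flip: lambda_circ)
    then have "y = a \<otimes> brace_lambda A (inv a) x"
      using a c[OF x(1)] x(2) by (simp add: circ_eq)
    then show "y \<in> a <# I"
      using lam[of "inv a" x] x a by (auto simp: l_coset_def)
  qed
  then show ?thesis
    using a N.coset_eq C.coset_eq by (simp add: a_r_coset_def a_l_coset_def)
qed

lemma brace_epi_quot:
  assumes I: "brace_ideal I A"
  shows "brace_epi A (brace_quot A I) ((+>) I)"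
proof -
  let ?Q = "brace_quot A I" and ?h = "(+>) I"
  interpret N: normal I "add_monoid A"
    using I by (simp add: brace_ideal_def)
  interpret C: normal I A
    using I by (simp add: brace_ideal_def)
  have Q_add: "add_monoid ?Q = add_monoid A Mod I"
    by (simp add: brace_quot_def FactGroup_def A_RCOSETS_def set_add_def)
  have surj: "?h ` carrier A = carrier ?Q"
    by (auto simp: brace_quot_def A_RCOSETS_def')
  have "carrier ?Q = rcosets I"
    using circ_coset_eq_add_coset[OF I] by (auto simp: brace_quot_def A_RCOSETS_def' RCOSETS_def)
  \<comment> \<open>\<open>?Q\<close> and \<open>A Mod I\<close> are different record types that
    share carrier, product and unit.\<close>
  then have circ_group: "group ?Q"
    by (intro group_record_cong[OF C.factorgroup_is_group]) (simp_all add: brace_quot_def FactGroup_def)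
  have add_group: "group (add_monoid ?Q)"
    unfolding Q_add by (rule N.factorgroup_is_group)
  have add: "?h (a \<oplus> b) = ?h a \<oplus>\<^bsub>?Q\<^esub> ?h b" if "a \<in> carrier A" "b \<in> carrier A" for a b
    using N.rcos_sum that by (simp add: brace_quot_def a_r_coset_def set_add_def)
  have circ: "?h (a \<otimes> b) = ?h a \<otimes>\<^bsub>?Q\<^esub> ?h b" if "a \<in> carrier A" "b \<in> carrier A" for a b
    using C.rcos_sum that by (simp add: brace_quot_def flip: circ_coset_eq_add_coset[OF I])
  have closed: "?h a \<in> carrier ?Q" if "a \<in> carrier A" for a
    using that surj by blast
  have hom: "group_hom (add_monoid A) (add_monoid ?Q) ?h"
    using add_group additive_group by (simp add: group_hom_def group_hom_axioms_def hom_def closed add)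
  have minus: "?h (\<ominus> a) = \<ominus>\<^bsub>?Q\<^esub> ?h a" if "a \<in> carrier A" for a
    using group_hom.hom_inv[OF hom, of a] that by (simp add: a_inv_def[of ?Q] flip: a_inv_def[of A])
  have "skew_left_brace ?Q"
  proof (rule skew_left_brace.intro)
    fix a b c assume "a \<in> carrier ?Q" "b \<in> carrier ?Q" "c \<in> carrier ?Q"
    then obtain x y z where xyz: "x \<in> carrier A" "y \<in> carrier A" "z \<in> carrier A"
      and abc: "a = ?h x" "b = ?h y" "c = ?h z"
      unfolding surj[symmetric] by blast
    have "a \<otimes>\<^bsub>?Q\<^esub> (b \<oplus>\<^bsub>?Q\<^esub> c) = ?h (x \<otimes> (y \<oplus> z))"
      using xyz by (simp add: abc add circ)
    also have "\<dots> = ?h ((x \<otimes> y \<oplus> \<ominus> x) \<oplus> x \<otimes> z)"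
      using brace_distrib[OF xyz] by (simp only: a_minus_def)
    also have "\<dots> = (a \<otimes>\<^bsub>?Q\<^esub> b \<ominus>\<^bsub>?Q\<^esub> a) \<oplus>\<^bsub>?Q\<^esub> a \<otimes>\<^bsub>?Q\<^esub> c"
      using xyz by (simp add: abc add circ minus a_minus_def)
    finally show "a \<otimes>\<^bsub>?Q\<^esub> (b \<oplus>\<^bsub>?Q\<^esub> c) = (a \<otimes>\<^bsub>?Q\<^esub> b \<ominus>\<^bsub>?Q\<^esub> a) \<oplus>\<^bsub>?Q\<^esub> a \<otimes>\<^bsub>?Q\<^esub> c" .
  qed (fact add_group circ_group)+
  then show ?thesis
    by (intro brace_epi.intro brace_epi_axioms.intro skew_left_brace_axioms add circ surj)
qed

lemma quot_eq_zero_iff: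
  assumes "brace_ideal I A" "a \<in> carrier A"
  shows "I +> a = \<zero>\<^bsub>brace_quot A I\<^esub> \<longleftrightarrow> a \<in> I"
proof -
  interpret N: normal I "add_monoid A"
    using assms(1) by (simp add: brace_ideal_def)
  show ?thesis
    using add.coset_join1[OF _ _ N.subgroup_axioms] add.coset_join2[OF _ N.subgroup_axioms] assms(2)
    by (auto simp: brace_quot_def a_r_coset_def)
qed

text \<open>Modulo \<open>I\<close> the left factor vanishes, and so does the star; membership in
  \<open>J\<close> is lambda-invariance of \<open>J\<close>.\<close>

lemma star_mem_ideals:
  assumes I: "brace_ideal I A" and J: "brace_ideal J A" and ij: "i \<in> I" "j \<in> J"
  shows "brace_star A i j \<in> I \<inter> J"
proof -
  have c: "i \<in> carrier A" "j \<in> carrier A"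
    using ij brace_ideal_subset[OF I] brace_ideal_subset[OF J] by auto
  interpret h: brace_epi A "brace_quot A I" "(+>) I"
    by (rule brace_epi_quot[OF I])
  have "I +> i = \<zero>\<^bsub>brace_quot A I\<^esub>"
    using quot_eq_zero_iff[OF I] ij c by simp
  then have "I +> brace_star A i j = \<zero>\<^bsub>brace_quot A I\<^esub>"
    using h.B.star_zero_left h.hom_closed[of j] c by (simp add: h.hom_star)
  then have "brace_star A i j \<in> I"
    using quot_eq_zero_iff[OF I] c by simp
  moreover have "brace_star A i j \<in> J"
    using J ij c by (simp add: brace_ideal_iff brace_star_def a_minus_def)
  ultimately show ?thesis
    by simp
qed

section \<open>Maximal ideals and their primeness\<close>

definition maximal_brace_ideal :: "'a set \<Rightarrow> bool"
  where "maximal_brace_ideal M \<longleftrightarrow> brace_ideal M A \<and> M \<noteq> carrier A \<and>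
    (\<forall>I. brace_ideal I A \<and> M \<subseteq> I \<longrightarrow> I = M \<or> I = carrier A)"

text \<open>The preimage \<open>P\<close> of the image of \<open>I\<close> in the quotient by
  \<open>M\<close> plays the role of the sum of \<open>I\<close> and \<open>M\<close>; it is
  strictly above \<open>M\<close>, hence everything.\<close>

lemma maximal_brace_ideal_covers:
  assumes M: "maximal_brace_ideal M" and I: "brace_ideal I A" "\<not> I \<subseteq> M" and a: "a \<in> carrier A"
  obtains i where "i \<in> I" "M +> i = M +> a"
proof -
  have M': "brace_ideal M A"
    using M by (simp add: maximal_brace_ideal_def)
  interpret h: brace_epi A "brace_quot A M" "(+>) M"
    by (rule brace_epi_quot[OF M'])
  define P where "P = {a \<in> carrier A. M +> a \<in> (+>) M ` I}"
  have P: "brace_ideal P A"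
    unfolding P_def by (intro h.brace_ideal_vimage h.brace_ideal_image I)
  have "M \<subseteq> P"
  proof
    fix m assume m: "m \<in> M"
    then have mc: "m \<in> carrier A"
      using brace_ideal_subset[OF M'] by blast
    then have "M +> m = M +> \<zero>"
      using quot_eq_zero_iff[OF M' mc] m h.hom_zero by simp
    moreover have "\<zero> \<in> I"
      using I by (simp add: brace_ideal_iff)
    ultimately show "m \<in> P"
      using mc by (simp add: P_def)
  qed
  moreover have "I \<subseteq> P"
    using brace_ideal_subset[OF I(1)] by (auto simp: P_def)
  ultimately have "P = carrier A"
    using M P I(2) by (auto simp: maximal_brace_ideal_def)
  then have "M +> a \<in> (+>) M ` I"
    using a by (auto simp: P_def)
  then show thesis
    using that by (metis imageE)
qed

text \<open>Any \<open>a\<close>, \<open>b\<close> have representatives modulo \<open>M\<close> in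
  \<open>I\<close> and \<open>J\<close>, whose star lies in \<open>I \<inter> J\<close>. If that
  were inside \<open>M\<close>, all stars would be in \<open>M\<close>.\<close>

lemma maximal_brace_ideal_prime:
  assumes M: "maximal_brace_ideal M" "\<not> brace_square A \<subseteq> M"
    and I: "brace_ideal I A" "\<not> I \<subseteq> M" and J: "brace_ideal J A" "\<not> J \<subseteq> M"
  shows "\<not> I \<inter> J \<subseteq> M"
proof
  assume IJ: "I \<inter> J \<subseteq> M"
  have M': "brace_ideal M A"
    using M by (simp add: maximal_brace_ideal_def)
  interpret h: brace_epi A "brace_quot A M" "(+>) M"
    by (rule brace_epi_quot[OF M'])
  have "brace_star A a b \<in> M" if ab: "a \<in> carrier A" "b \<in> carrier A" for a b
  proof -
    obtain i where i: "i \<in> I" "M +> i = M +> a"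
      by (rule maximal_brace_ideal_covers[OF M(1) I ab(1)])
    obtain j where j: "j \<in> J" "M +> j = M +> b"
      by (rule maximal_brace_ideal_covers[OF M(1) J ab(2)])
    have c: "i \<in> carrier A" "j \<in> carrier A"
      using i j brace_ideal_subset[OF I(1)] brace_ideal_subset[OF J(1)] by auto
    have "M +> brace_star A a b = M +> brace_star A i j"
      using ab c i j by (simp add: h.hom_star)
    moreover have "brace_star A i j \<in> M"
      using star_mem_ideals[OF I(1) J(1)] i j IJ by blast
    ultimately show ?thesis
      using quot_eq_zero_iff[OF M'] ab c by (metis star_closed)
  qed
  then show False
    using brace_square_subset[OF M'] M(2) by blast
qed

text \<open>These are the maximal ideals \<open>M\<close> such that the two operations differ on the
  quotient by \<open>M\<close>.\<close>

definition nontrivial_spectrum :: "'a set set"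
  where "nontrivial_spectrum = {M. maximal_brace_ideal M \<and> \<not> brace_square A \<subseteq> M}"

text \<open>Primeness is iterated over \<open>F\<close>, using that distinct maximal ideals are
  incomparable. \<open>K\<close> varies in the induction so that it can absorb each
  \<open>N\<close>; it also makes the empty intersection harmless.\<close>

lemma Int_spectrum_not_subset:
  assumes "finite F" "F \<subseteq> nontrivial_spectrum" "M \<in> nontrivial_spectrum - F"
    and "brace_ideal K A" "\<not> K \<subseteq> M"
  shows "brace_ideal (K \<inter> \<Inter>F) A \<and> \<not> K \<inter> \<Inter>F \<subseteq> M"
  using assms
proof (induction F arbitrary: K)
  case (insert N F)
  have N: "brace_ideal N A" and M: "maximal_brace_ideal M" "\<not> brace_square A \<subseteq> M"
    using insert.prems by (auto simp: nontrivial_spectrum_def maximal_brace_ideal_def)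
  have "\<not> N \<subseteq> M"
    using insert.prems by (auto simp: nontrivial_spectrum_def maximal_brace_ideal_def)
  then have "\<not> K \<inter> N \<subseteq> M"
    by (intro maximal_brace_ideal_prime M N insert.prems)
  then have "brace_ideal ((K \<inter> N) \<inter> \<Inter>F) A \<and> \<not> (K \<inter> N) \<inter> \<Inter>F \<subseteq> M"
    using insert.prems N by (intro insert.IH brace_ideal_Int) auto
  then show ?case
    by (simp add: Int_assoc)
qed simp

section \<open>Finiteness of the nontrivial spectrum, and translates avoiding it\<close>

lemma finite_nontrivial_spectrum:
  assumes dcc: "descending_chain_condition (ideals_below A (brace_square A))"
  shows "finite nontrivial_spectrum"
proof (rule ccontr)
  assume "infinite nontrivial_spectrum"
  then obtain f :: "nat \<Rightarrow> 'a set" where f: "inj f" "range f \<subseteq> nontrivial_spectrum"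
    by (metis infinite_countable_subset)
  \<comment> \<open>The strict bound gives \<open>I 0 = brace_square A\<close>, and
    \<open>f n\<close> first enters at \<open>Suc n\<close>: \<open>I (Suc n)\<close> is inside
    \<open>f n\<close> while \<open>I n\<close> is not, so the chain never stabilizes.\<close>
  define I where "I n = brace_square A \<inter> \<Inter>(f ` {..<n})" for n
  have I: "brace_ideal (I n) A" "\<not> I n \<subseteq> f n" for n
  proof -
    have "f n \<in> nontrivial_spectrum - f ` {..<n}" "\<not> brace_square A \<subseteq> f n"
      using f by (auto simp: nontrivial_spectrum_def dest: injD)
    then have "brace_ideal (I n) A \<and> \<not> I n \<subseteq> f n"
      unfolding I_def using f(2) by (intro Int_spectrum_not_subset brace_ideal_square) auto
    then show "brace_ideal (I n) A" "\<not> I n \<subseteq> f n"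
      by auto
  qed
  have "antimono I"
    unfolding I_def by (intro antimonoI) auto
  moreover have "range I \<subseteq> ideals_below A (brace_square A)"
    using I(1) by (auto simp: ideals_below_def I_def)
  ultimately obtain n where "I (Suc n) = I n"
    using dcc unfolding descending_chain_condition_def by (metis le_Suc_eq order_refl)
  moreover have "I (Suc n) \<subseteq> f n"
    by (auto simp: I_def)
  ultimately show False
    using I(2)[of n] by simp
qed

text \<open>\<open>g\<close> is corrected for one ideal at a time. If \<open>y \<oplus> g\<close>
  lies in the new \<open>M\<close>, adding some \<open>d\<close> in \<open>brace_square A\<close>
  and in all members of \<open>F\<close>, but not in \<open>M\<close>, keeps the classes modulo
  \<open>F\<close> and leaves \<open>M\<close>.\<close>

lemma avoid_spectrum:
  assumes "finite F" "F \<subseteq> nontrivial_spectrum" "y \<in> carrier A"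
  shows "\<exists>g\<in>brace_square A. \<forall>M\<in>F. y \<oplus> g \<notin> M"
  using assms
proof (induction F)
  case empty
  then show ?case
    using brace_ideal_square by (auto simp: brace_ideal_iff)
next
  case (insert M F)
  then obtain g where g: "g \<in> brace_square A" "\<forall>N\<in>F. y \<oplus> g \<notin> N"
    by auto
  show ?case
  proof (cases "y \<oplus> g \<in> M")
    case True
    have "M \<in> nontrivial_spectrum - F" "\<not> brace_square A \<subseteq> M"
      using insert by (auto simp: nontrivial_spectrum_def)
    then have "\<not> brace_square A \<inter> \<Inter>F \<subseteq> M"
      using Int_spectrum_not_subset[of F M "brace_square A"] insert brace_ideal_square by auto
    then obtain d where d: "d \<in> brace_square A" "\<forall>N\<in>F. d \<in> N" "d \<notin> M"
      by blast
    have c: "g \<in> carrier A" "d \<in> carrier A"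
      using g d brace_ideal_subset[OF brace_ideal_square] by auto
    \<comment> \<open>The first identity would put \<open>d\<close> into \<open>M\<close>, the
      second would put \<open>y \<oplus> g\<close> into a member of \<open>F\<close>.\<close>
    have cancel: "\<ominus> (y \<oplus> g) \<oplus> (y \<oplus> (g \<oplus> d)) = d" "(y \<oplus> (g \<oplus> d)) \<oplus> \<ominus> d = y \<oplus> g"
      using c insert.prems by (simp_all add: add.m_assoc add.inv_mult_group)
    have "y \<oplus> (g \<oplus> d) \<notin> N" if "N \<in> insert M F" for N
    proof
      assume y: "y \<oplus> (g \<oplus> d) \<in> N"
      have N: "brace_ideal N A"
        using that insert.prems by (auto simp: nontrivial_spectrum_def maximal_brace_ideal_def)
      show False
      proof (cases "N = M")
        case True
        then have "\<ominus> (y \<oplus> g) \<oplus> (y \<oplus> (g \<oplus> d)) \<in> N"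
          using N y \<open>y \<oplus> g \<in> M\<close> unfolding brace_ideal_iff by blast
        then show False
          using True d cancel by simp
      next
        case False
        then have "N \<in> F"
          using that by simp
        then have "(y \<oplus> (g \<oplus> d)) \<oplus> \<ominus> d \<in> N"
          using N y d(2) unfolding brace_ideal_iff by blast
        then show False
          using g \<open>N \<in> F\<close> cancel by simp
      qed
    qed
    moreover have "g \<oplus> d \<in> brace_square A"
      using g d brace_ideal_square by (simp add: brace_ideal_iff)
    ultimately show ?thesis
      by blast
  qed (use g in auto)
qed

section \<open>Maximal ideals above proper ideals, and lifting of generators\<close>

lemma maximal_brace_ideal_exists:
  assumes fw: "finite_weight A" and N: "brace_ideal N A" "N \<noteq> carrier A"
  obtains M where "maximal_brace_ideal M" "N \<subseteq> M"
proof -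
  obtain S where S: "finite S" "ideal_generates A S"
    using fw by (auto simp: finite_weight_def)
  define X where "X = {I. brace_ideal I A \<and> N \<subseteq> I \<and> I \<noteq> carrier A}"
  have "\<exists>M\<in>X. \<forall>I\<in>X. M \<subseteq> I \<longrightarrow> I = M"
  proof (rule subset_Zorn_nonempty)
    show "X \<noteq> {}"
      using N by (auto simp: X_def)
  next
    fix C assume C: "C \<noteq> {}" "subset.chain X C"
    then have CX: "C \<subseteq> X"
      by (simp add: subset.chain_def)
    have "brace_ideal (\<Union>C) A"
    proof (rule brace_ideal_Union_chain[OF C(1)])
      show "brace_ideal I A" if "I \<in> C" for I
        using that CX by (auto simp: X_def)
      show "I \<subseteq> J \<or> J \<subseteq> I" if "I \<in> C" "J \<in> C" for I J
        using C(2) that by (auto simp: subset_chain_def)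
    qed
    moreover have "N \<subseteq> \<Union>C"
      using C(1) CX by (auto simp: X_def)
    \<comment> \<open>Finite weight enters here: a finite generating set inside the union already
      lies in one member of the chain, which is proper.\<close>
    moreover have "\<Union>C \<noteq> carrier A"
    proof
      assume "\<Union>C = carrier A"
      then have "S \<subseteq> \<Union>C"
        using S by (auto simp: ideal_generates_iff)
      then obtain I where "I \<in> C" "S \<subseteq> I"
        using finite_subset_Union_chain[OF S(1) _ C] by blast
      then show False
        using S CX by (auto simp: ideal_generates_iff X_def)
    qed
    ultimately show "\<Union>C \<in> X"
      by (simp add: X_def)
  qed
  then obtain M where M: "M \<in> X" "\<forall>I\<in>X. M \<subseteq> I \<longrightarrow> I = M"
    by blast
  show thesis
  proof
    show "N \<subseteq> M"
      using M by (simp add: X_def)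
    show "maximal_brace_ideal M"
      unfolding maximal_brace_ideal_def
    proof (intro conjI allI impI)
      fix I assume "brace_ideal I A \<and> M \<subseteq> I"
      then show "I = M \<or> I = carrier A"
        using M \<open>N \<subseteq> M\<close> by (auto simp: X_def)
    qed (use M in \<open>auto simp: X_def\<close>)
  qed
qed

text \<open>\<open>gen\<close> says, inside \<open>A\<close>, that \<open>insert y T\<close>
  generates modulo \<open>brace_square A\<close>. Only the generator \<open>y\<close> is changed, so
  the number of generators does not grow.\<close>

lemma lift_generators:
  assumes fw: "finite_weight A"
    and dcc: "descending_chain_condition (ideals_below A (brace_square A))"
    and yT: "insert y T \<subseteq> carrier A"
    and gen: "\<And>I. brace_ideal I A \<Longrightarrow> brace_square A \<subseteq> I \<Longrightarrow> insert y T \<subseteq> I \<Longrightarrow> I = carrier A"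
  obtains g where "g \<in> brace_square A" "ideal_generates A (insert (y \<oplus> g) T)"
proof -
  obtain g where g: "g \<in> brace_square A" "\<forall>M\<in>nontrivial_spectrum. y \<oplus> g \<notin> M"
    using avoid_spectrum[OF finite_nontrivial_spectrum[OF dcc], of y] yT by auto
  have gc: "g \<in> carrier A"
    using g brace_ideal_subset[OF brace_ideal_square] by auto
  have "N = carrier A" if N: "brace_ideal N A" "insert (y \<oplus> g) T \<subseteq> N" for N
  proof (rule ccontr)
    assume "N \<noteq> carrier A"
    then obtain M where M: "maximal_brace_ideal M" "N \<subseteq> M"
      using maximal_brace_ideal_exists[OF fw N(1)] by blast
    then have M': "brace_ideal M A" "M \<noteq> carrier A"
      by (auto simp: maximal_brace_ideal_def)
    \<comment> \<open>\<open>M\<close> contains \<open>y \<oplus> g\<close>, which avoids every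
      member of the spectrum.\<close>
    have "M \<notin> nontrivial_spectrum"
      using g N M by blast
    then have sq: "brace_square A \<subseteq> M"
      using M by (simp add: nontrivial_spectrum_def)
    then have "(y \<oplus> g) \<oplus> \<ominus> g \<in> M"
      using M' g N M unfolding brace_ideal_iff by blast
    then have "y \<in> M"
      using yT gc by (simp add: add.m_assoc)
    then show False
      using gen[OF M'(1) sq] N M M'(2) by blast
  qed
  then have "ideal_generates A (insert (y \<oplus> g) T)"
    using yT gc by (simp add: ideal_generates_iff)
  with g(1) show thesis
    by (rule that)
qed

text \<open>Images and preimages translate between ideals of the quotient and ideals of
  \<open>A\<close> above \<open>J\<close>. The right-hand side has the form of the hypothesis
  \<open>gen\<close> of \<open>lift_generators\<close>.\<close>

lemma ideal_generates_quot_iff: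
  assumes J: "brace_ideal J A" and S: "S \<subseteq> carrier A"
  shows "ideal_generates (brace_quot A J) ((+>) J ` S) \<longleftrightarrow>
    (\<forall>I. brace_ideal I A \<and> J \<subseteq> I \<and> S \<subseteq> I \<longrightarrow> I = carrier A)"
    (is "?L \<longleftrightarrow> ?R")
proof -
  let ?Q = "brace_quot A J" and ?h = "(+>) J"
  interpret h: brace_epi A ?Q ?h
    by (rule brace_epi_quot[OF J])
  show ?thesis
  proof
    assume L: ?L
    show ?R
    proof (intro allI impI, elim conjE)
      fix I assume I: "brace_ideal I A" "J \<subseteq> I" "S \<subseteq> I"
      have "?h ` I = carrier ?Q"
        using L h.brace_ideal_image[OF I(1)] image_mono[OF I(3), of ?h]
        unfolding h.B.ideal_generates_iff by blast
      have "a \<in> I" if a: "a \<in> carrier A" for a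
      proof -
        have "?h a \<in> ?h ` I"
          using \<open>?h ` I = carrier ?Q\<close> h.hom_closed[OF a] by simp
        then obtain i where i: "i \<in> I" "?h a = ?h i"
          by blast
        have ic: "i \<in> carrier A"
          using i brace_ideal_subset[OF I(1)] by blast
        \<comment> \<open>\<open>a\<close> and \<open>i\<close> agree modulo \<open>J\<close>, and
          \<open>J \<subseteq> I\<close>, so \<open>a\<close> lies in \<open>I\<close>.\<close>
        then have "?h (a \<oplus> \<ominus> i) = \<zero>\<^bsub>?Q\<^esub>"
          using a i h.B.add.r_inv[of "?h i"] h.hom_closed[OF ic] by (simp add: h.hom_add h.hom_minus)
        then have "a \<oplus> \<ominus> i \<in> I"
          using quot_eq_zero_iff[OF J, of "a \<oplus> \<ominus> i"] a ic I(2) by auto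
        then have "(a \<oplus> \<ominus> i) \<oplus> i \<in> I"
          using i I(1) unfolding brace_ideal_iff by blast
        then show "a \<in> I"
          using a ic by (simp add: add.m_assoc)
      qed
      then show "I = carrier A"
        using brace_ideal_subset[OF I(1)] by blast
    qed
  next
    assume R: ?R
    have "K = carrier ?Q" if K: "brace_ideal K ?Q" "?h ` S \<subseteq> K" for K
    proof -
      let ?P = "{a \<in> carrier A. ?h a \<in> K}"
      have "J \<subseteq> ?P"
      proof
        fix x assume x: "x \<in> J"
        then have "x \<in> carrier A"
          using brace_ideal_subset[OF J] by blast
        with x show "x \<in> ?P"
          using quot_eq_zero_iff[OF J, of x] K(1) by (simp add: h.B.brace_ideal_iff)
      qed
      moreover have "S \<subseteq> ?P"
        using S K(2) by auto
      ultimately have "?P = carrier A"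
        using R h.brace_ideal_vimage[OF K(1)] by blast
      then have "carrier ?Q \<subseteq> K"
        unfolding h.surj[symmetric] by blast
      then show ?thesis
        using h.B.brace_ideal_subset[OF K(1)] by blast
    qed
    then show ?L
      using S by (auto simp: h.B.ideal_generates_iff)
  qed
qed

end

section \<open>Comparison of the two weights\<close>

theorem theorem4p5:
  fixes A :: "('a, 'b) ring_scheme"
  assumes "skew_left_brace A"
    and "finite_weight A"
    and "descending_chain_condition (ideals_below A (brace_square A))"
  shows "brace_weight A = brace_weight (brace_quot A (brace_square A))"
proof -
  interpret skew_left_brace A
    by fact
  note J = brace_ideal_square
  let ?Q = "brace_quot A (brace_square A)" and ?h = "(+>\<^bsub>A\<^esub>) (brace_square A)"
  interpret h: brace_epi A ?Q ?h
    by (rule brace_epi_quot[OF J])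
  let ?W = "{enat (card S) | S. finite S \<and> ideal_generates A S}"
  let ?V = "{enat (card S) | S. finite S \<and> ideal_generates ?Q S}"
  show ?thesis
  proof (cases "carrier A = {\<zero>\<^bsub>A\<^esub>}")
    case True
    then have "carrier ?Q = {\<zero>\<^bsub>?Q\<^esub>}"
      using h.surj h.hom_zero by auto
    with True show ?thesis
      by (simp add: brace_weight_def)
  next
    case A: False
    show ?thesis
    proof (cases "carrier ?Q = {\<zero>\<^bsub>?Q\<^esub>}")
      case True
      then have perfect: "carrier A \<subseteq> brace_square A"
        using quot_eq_zero_iff[OF J] h.hom_closed by blast
      have gen: "I = carrier A" if "brace_ideal I A" "brace_square A \<subseteq> I" for I
        using that perfect brace_ideal_subset[of I] by blast
      \<comment> \<open>The zero quotient has weight 1 by convention, so \<open>A\<close> must be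
        generated by one element. Here \<open>brace_square A\<close> is all of \<open>A\<close>, so
        \<open>\<zero>\<close> alone generates modulo it and can be lifted.\<close>
      obtain g where g: "ideal_generates A {\<zero>\<^bsub>A\<^esub> \<oplus>\<^bsub>A\<^esub> g}"
        using lift_generators[OF assms(2,3), of "\<zero>\<^bsub>A\<^esub>" "{}"] gen by auto
      have "Inf ?W \<le> enat (card {\<zero>\<^bsub>A\<^esub> \<oplus>\<^bsub>A\<^esub> g})"
        by (rule Inf_lower) (use g in blast)
      moreover have "1 \<le> Inf ?W"
      proof (rule Inf_greatest)
        fix w assume "w \<in> ?W"
        then obtain S where S: "w = enat (card S)" "finite S" "ideal_generates A S"
          by blast
        with A have "card S > 0"
          using ideal_generates_nonempty by (simp add: card_gt_0_iff)
        with S show "1 \<le> w"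
          by (simp add: one_enat_def)
      qed
      ultimately have "Inf ?W = 1"
        by (simp add: one_enat_def)
      with A True show ?thesis
        by (simp add: brace_weight_def)
    next
      case Q: False
      have "Inf ?W \<le> Inf ?V"
      proof (rule Inf_greatest)
        fix v assume "v \<in> ?V"
        then obtain T where T: "v = enat (card T)" "finite T" "ideal_generates ?Q T"
          by blast
        then have "T \<subseteq> ?h ` carrier A"
          by (simp add: h.B.ideal_generates_iff h.surj)
        \<comment> \<open>One representative per element of \<open>T\<close>, so that
          \<open>S\<close> and \<open>T\<close> have the same size.\<close>
        then obtain S where S: "S \<subseteq> carrier A" "inj_on ?h S" "T = ?h ` S"
          by (auto simp: subset_image_inj)
        have fin: "finite S"
          using S T(2) by (simp add: finite_image_iff)
        obtain y where "y \<in> S"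
          using h.B.ideal_generates_nonempty[OF T(3) Q] S(3) by blast
        then obtain R where R: "S = insert y R" "y \<notin> R"
          using mk_disjoint_insert[of y S] by blast
        have gen: "I = carrier A" if "brace_ideal I A" "brace_square A \<subseteq> I" "insert y R \<subseteq> I" for I
        proof -
          have "\<forall>I. brace_ideal I A \<and> brace_square A \<subseteq> I \<and> S \<subseteq> I \<longrightarrow> I = carrier A"
            using T(3) unfolding S(3) ideal_generates_quot_iff[OF J S(1)] .
          with that R(1) show ?thesis
            by blast
        qed
        have "insert y R \<subseteq> carrier A"
          using S(1) R(1) by simp
        then obtain g where "g \<in> brace_square A"
          and g: "ideal_generates A (insert (y \<oplus>\<^bsub>A\<^esub> g) R)"
          by (rule lift_generators[OF assms(2,3) _ gen])
        have "finite (insert (y \<oplus>\<^bsub>A\<^esub> g) R)"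
          using fin R(1) by simp
        with g have "Inf ?W \<le> enat (card (insert (y \<oplus>\<^bsub>A\<^esub> g) R))"
          by (intro Inf_lower CollectI exI[of _ "insert (y \<oplus>\<^bsub>A\<^esub> g) R"] conjI HOL.refl)
        \<comment> \<open>Only an inequality, since the modified generator may already lie in
          \<open>R\<close>.\<close>
        also have "card (insert (y \<oplus>\<^bsub>A\<^esub> g) R) \<le> card S"
          using fin R by (simp add: card_insert_if)
        also have "card S = card T"
          using S by (simp add: card_image)
        finally show "Inf ?W \<le> v"
          by (simp add: T)
      qed
      moreover have "Inf ?V \<le> Inf ?W"
      proof (rule Inf_greatest)
        fix w assume "w \<in> ?W"
        then obtain S where S: "w = enat (card S)" "finite S" "ideal_generates A S"
          by blast
        then have "ideal_generates ?Q (?h ` S)"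
          using ideal_generates_quot_iff[OF J] by (simp add: ideal_generates_iff)
        then have "Inf ?V \<le> enat (card (?h ` S))"
          by (intro Inf_lower CollectI exI[of _ "?h ` S"] conjI HOL.refl finite_imageI S)
        also have "\<dots> \<le> w"
          using S by (simp add: card_image_le)
        finally show "Inf ?V \<le> w" .
      qed
      ultimately show ?thesis
        using A Q by (simp add: brace_weight_def)
    qed
  qed
qed

end
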